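(* Let $H$ be a Tonelli Hamiltonian on $\mathbb T^d$ with associated Lagrangian $L$. Let $(h_n)$ be mesh sizes and $(\tau_n)$ positive time steps with $\tau_n\to0$, $h_n\to0$ and $h_n/\tau_n\to0$. Let $\mu_*$ be a full-support Mather measure, i.e. a continuous Mather measure with $\operatorname{spt}(\mu_* )=\widetilde{\mathcal M}_L$. Let $(\nu_n)_n$ be a recovery sequence for $\mu_*$ (see context), and set $$\eta_n:=\mathcal A_{h_n,\tau_n}(\nu_n)-\bar L(h_n,\tau_n).$$ If $\varepsilon_n\to0$ and $\eta_n\le\varepsilon_n$ for all sufficiently large $n$, then for every fixed $r>0$ there exists $\delta_r>0$ such that $$\widetilde{\mathcal M}_L\subset\mathcal S_{h_n,\tau_n}^{\varepsilon_n,r,\delta_r}$$ for all sufficiently large $n$.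
   Context: $\mathbb T^d=\mathbb R^d/\mathbb Z^d$. $H\in C^2(\mathbb T^d\times\mathbb R^d)$ is a Tonelli Hamiltonian: $D^2_{pp}H(x,p)>0$ everywhere and $H$ is superlinear in $p$. The Tonelli Lagrangian is $L(x,v)=\sup_{p\in\mathbb R^d}\{p\cdot v-H(x,p)\}$; it is of class $C^2$, strictly convex in $v$, and superlinear: for every $K>0$ there is $C(K)\in\mathbb R$ with $L(x,v)\ge K|v|-C(K)$ for all $(x,v)$. $\alpha(H)$ is the unique constant for which $H(x,Du)=\alpha(H)$ on $\mathbb T^d$ has a viscosity solution. Let $X=\mathbb T^d\times\mathbb R^d$ with a fixed product metric $d_X$ built from the flat distance and the Euclidean distance (e.g. $d_X^2=d_{\mathbb T^d}^2+|\cdot|^2$), and $B_r(z)$ its open balls. A probability measure $\mu$ on $X$ is closed if $\int v\cdot D\phi(x)\,d\mu(x,v)=0$ for all $\phi\in C^1(\mathbb T^d)$. A (continuous) Mather measure is a closed probability measure minimizing $\int L\,d\mu$ among closed probability measures (the minimum is $-\alpha(H)$). The Mather set $\widetilde{\mathcal M}_L$ is the closure of the union of the supports of all Mather measures; it is compact. Mesh sizes are always of the form $h=1/N$ with $N\ge1$ an integer. The grid is $\mathcal G_h=\{x_i=ih \bmod \mathbb Z^d: i\in\{0,\dots,N-1\}^d\}$, with grid points identified with representatives in $[0,1)^d$. Put $v_{ij}^\ell=(x_j+\ell-x_i)/\tau$ for $\ell\in\mathbb Z^d$. $\mathcal H_{h,\tau}$ is the set of families $\mu=(\mu_{ij}^\ell)_{x_i,x_j\in\mathcal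 G_h,\ell\in\mathbb Z^d}$ with $\mu_{ij}^\ell\ge0$, $\sum_{i,j,\ell}\mu_{ij}^\ell=1$ and $\sum_{j,\ell}\mu_{ij}^\ell=\sum_{j,\ell}\mu_{ji}^\ell$ for every $x_i$. Reconstruction: $\mathcal R_{h,\tau}\mu=\sum_{i,j,\ell}\mu_{ij}^\ell\delta_{(x_i,v_{ij}^\ell)}\in\mathcal P(X)$. Action: $\mathcal A_{h,\tau}(\mu)=\sum_{i,j,\ell}L(x_i,v_{ij}^\ell)\mu_{ij}^\ell$. $\bar L(h,\tau)=\min_{\mathcal H_{h,\tau}}\mathcal A_{h,\tau}$ (equivalently, the unique constant for which $u(x_j)+\tau\bar L(h,\tau)=\min_{x_i\in\mathcal G_h,\ell\in\mathbb Z^d}\{u(x_i)+\tau L(x_i,v_{ij}^\ell)\}$ has a solution $u:\mathcal G_h\to\mathbb R$). Recovery sequence for a Mather measure $\mu$: $\nu_n\in\mathcal H_{h_n,\tau_n}$ such that $\mathcal R_{h_n,\tau_n}\nu_n\rightharpoonup\mu$ narrowly, $\mathcal A_{h_n,\tau_n}(\nu_n)\to-\alpha(H)$, and $0\le\mathcal A_{h_n,\tau_n}(\nu_n)-\bar L(h_n,\tau_n)\le C(\tau_n+h_n/\tau_n)$ for some constant $C>0$. Such sequences exist. Mass-threshold sets: for $\varepsilon\ge0$, $\mathcal H_{h,\tau}^\varepsilon=\{\mu\in\mathcal H_{h,\tau}:\mathcal A_{h,\tau}(\mu)\le\bar L(h,\tau)+\varepsilon\}$ and $\widetilde{\mathcal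 H}_{h,\tau}^\varepsilon=\{\mathcal R_{h,\tau}\mu:\mu\in\mathcal H_{h,\tau}^\varepsilon\}$. Fix $\kappa:[0,\infty)\to[0,1]$ nonincreasing and Lipschitz with $\kappa=1$ on $[0,1/2]$ and $\kappa=0$ on $[1,\infty)$. For $\nu\in\mathcal P(X)$, $r>0$, $z\in X$ let $m_{\nu,r}(z)=\int_X\kappa(d_X(z,w)/r)\,d\nu(w)$, and $Q_{h,\tau,r}^\varepsilon(z)=\sup_{\widetilde\mu\in\widetilde{\mathcal H}_{h,\tau}^\varepsilon}m_{\widetilde\mu,r}(z)$. For $0<\delta\le1$, $\mathcal S_{h,\tau}^{\varepsilon,r,\delta}=\{z\in X:Q_{h,\tau,r}^\varepsilon(z)\ge\delta\}$. *)

theory Defs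
  imports "HOL-Probability.Probability"
begin

section \<open>The flat torus\<close>

definition lattice_rel :: "real ^ 'n::finite \<Rightarrow> real ^ 'n \<Rightarrow> bool" where
  "lattice_rel x y \<longleftrightarrow> (\<forall>k. x $ k - y $ k \<in> \<int>)"

lemma lattice_rel_equivp: "equivp (lattice_rel :: real ^ 'n::finite \<Rightarrow> _)"
proof (rule equivpI)
  show "reflp (lattice_rel :: real ^ 'n \<Rightarrow> _)"
    by (auto simp: reflp_def lattice_rel_def)
  show "symp (lattice_rel :: real ^ 'n \<Rightarrow> _)"
    unfolding symp_def lattice_rel_def by (metis Ints_minus minus_diff_eq)
  show "transp (lattice_rel :: real ^ 'n \<Rightarrow> _)"
    unfolding transp_def lattice_rel_def by (metis Ints_add diff_add_cancel add_diff_eq)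
qed

quotient_type 'n torus = "real ^ 'n::finite" / lattice_rel
  morphisms rep_torus proj
  by (rule lattice_rel_equivp)

lemma proj_eq_iff: "proj x = proj y \<longleftrightarrow> (\<forall>k. x $ k - y $ k \<in> \<int>)"
  using torus.abs_eq_iff lattice_rel_def by blast

lemma proj_surj: "\<exists>x. proj x = a"
  by (metis Quotient_abs_rep Quotient_torus)

lemma proj_shift:
  assumes "proj x = proj x'"
  shows "proj (y + (x - x')) = proj y"
  using assms by (auto simp: proj_eq_iff)

lemma closed_proj_fiber: "closed (proj -` {a})"
proof -
  obtain x where x: "proj x = a" using proj_surj by blast
  have "proj -` {a} = (\<Inter>k. {y. y $ k - x $ k \<in> \<int>})"
    using x by (auto simp: proj_eq_iff)
  moreover have "closed {y. y $ k - x $ k \<in> \<int>}" for k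
  proof -
    have "{y. y $ k - x $ k \<in> \<int>} = (\<lambda>y. y $ k - x $ k) -` \<int>" by auto
    moreover have "closed ((\<lambda>y. y $ k - x $ k) -` (\<int> :: real set))"
      by (intro closed_vimage closed_Ints continuous_intros)
    ultimately show ?thesis by simp
  qed
  ultimately show ?thesis by auto
qed

text \<open>The flat distance is the distance of the two lattice orbits in Euclidean space.\<close>

instantiation torus :: (finite) metric_space
begin

definition dist_torus :: "'a torus \<Rightarrow> 'a torus \<Rightarrow> real" where
  "dist_torus a b = setdist (proj -` {a}) (proj -` {b})"

definition uniformity_torus :: "('a torus \<times> 'a torus) filter" where
  "uniformity_torus = (INF e\<in>{0 <..}. principal {(x, y). dist x y < e})"

definition open_torus :: "'a torus set \<Rightarrow> bool" where
  "open_torus U \<longleftrightarrow> (\<forall>x\<in>U. eventually (\<lambda>(x', y). x' = x \<longrightarrow> y \<in> U) uniformity)"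

lemma dist_torus_infdist: "dist (proj x) b = infdist x (proj -` {b})"
proof -
  let ?B = "proj -` {b}"
  obtain b0 where b0: "proj b0 = b" using proj_surj by blast
  have inv: "infdist x' ?B = infdist x ?B" if "proj x' = proj x" for x' x
  proof -
    have le: "infdist u ?B \<le> infdist v ?B" if uv: "proj u = proj v" for u v
    proof -
      have "infdist u ?B \<le> dist v c" if "c \<in> ?B" for c
      proof -
        have "c + (u - v) \<in> ?B" using that proj_shift[OF uv] by auto
        then have "infdist u ?B \<le> dist u (c + (u - v))" by (rule infdist_le)
        also have "\<dots> = dist v c" by (simp add: dist_norm algebra_simps)
        finally show ?thesis .
      qed
      moreover have "?B \<noteq> {}" using b0 by auto
      ultimately show ?thesis
        unfolding infdist_notempty[OF \<open>?B \<noteq> {}\<close>, of v] by (intro cINF_greatest)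
    qed
    show ?thesis using le[of x' x] le[of x x'] that by auto
  qed
  have ne: "?B \<noteq> {}" using b0 by auto
  have "setdist (proj -` {proj x}) ?B = infdist x ?B"
  proof (rule antisym)
    have "setdist (proj -` {proj x}) ?B \<le> dist x y" if "y \<in> ?B" for y
      using that by (intro setdist_le_dist) auto
    then show "setdist (proj -` {proj x}) ?B \<le> infdist x ?B"
      unfolding infdist_notempty[OF ne] using ne by (intro cINF_greatest)
    show "infdist x ?B \<le> setdist (proj -` {proj x}) ?B"
    proof (rule le_setdistI)
      fix x' y assume "x' \<in> proj -` {proj x}" "y \<in> ?B"
      then show "infdist x ?B \<le> dist x' y"
        using inv[of x' x] infdist_le[of y ?B x'] by auto
    qed (use ne in auto)
  qed
  then show ?thesis by (simp add: dist_torus_def)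
qed

lemma dist_torus_le: "dist (proj x) (proj y) \<le> dist x y"
  by (simp add: dist_torus_infdist infdist_le)

instance
proof
  fix a b c :: "'a torus"
  obtain x where x: "proj x = a" using proj_surj by blast
  obtain y where y: "proj y = b" using proj_surj by blast
  obtain z where z: "proj z = c" using proj_surj by blast
  show "dist a b = 0 \<longleftrightarrow> a = b"
  proof -
    have "proj -` {b} \<noteq> {}" using y by auto
    then have "infdist x (proj -` {b}) = 0 \<longleftrightarrow> x \<in> proj -` {b}"
      using in_closed_iff_infdist_zero[OF closed_proj_fiber] by metis
    then show ?thesis using x dist_torus_infdist[of x b] by auto
  qed
  show "dist a b \<le> dist a c + dist b c"
  proof -
    have sym: "dist b c = dist c b" by (simp add: dist_torus_def setdist_sym)
    have "dist a b - dist c b \<le> dist x w" if "w \<in> proj -` {c}" for w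
    proof -
      have "dist a b = infdist x (proj -` {b})" using x dist_torus_infdist by metis
      moreover have "dist c b = infdist w (proj -` {b})" using that dist_torus_infdist by force
      ultimately show ?thesis using infdist_triangle[of x "proj -` {b}" w] by simp
    qed
    moreover have "proj -` {c} \<noteq> {}" using z by auto
    ultimately have "dist a b - dist c b \<le> infdist x (proj -` {c})"
      unfolding infdist_notempty[OF \<open>proj -` {c} \<noteq> {}\<close>] by (intro cINF_greatest)
    then show ?thesis using x sym dist_torus_infdist[of x c] by auto
  qed
qed (auto simp: uniformity_torus_def open_torus_def)

end

lemma continuous_proj: "continuous_on UNIV proj"
  unfolding continuous_on_iff using dist_torus_le le_less_trans by blast

lemma open_torus_iff: "open U \<longleftrightarrow> open (proj -` U)"
proof
  show "open (proj -` U)" if "open U"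
    by (rule open_vimage[OF that continuous_proj])
  assume op: "open (proj -` U)"
  show "open U"
    unfolding open_dist
  proof
    fix a assume "a \<in> U"
    obtain x where x: "proj x = a" using proj_surj by blast
    then obtain e where e: "e > 0" "\<And>y. dist y x < e \<Longrightarrow> proj y \<in> U"
      using op \<open>a \<in> U\<close> unfolding open_dist by force
    have "b \<in> U" if "dist b a < e" for b
    proof -
      have "(INF y\<in>proj -` {b}. dist x y) < e" "proj -` {b} \<noteq> {}"
        using that x proj_surj[of b] dist_torus_infdist[of x b]
        by (auto simp: infdist_def dist_commute split: if_splits)
      then obtain y where "y \<in> proj -` {b}" "dist x y < e"
        by (metis cINF_less_iff bdd_belowI2 zero_le_dist)
      then show ?thesis using e(2)[of y] by (simp add: dist_commute)
    qed
    then show "\<exists>e>0. \<forall>y. dist y a < e \<longrightarrow> y \<in> U" using e(1) by blast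
  qed
qed

text \<open>
  The phase space \<open>X\<close> is the type \<open>'n torus \<times> (real ^ 'n)\<close>; its library metric is
  \<open>sqrt (dist\<^sup>2 + dist\<^sup>2)\<close>.
\<close>

section \<open>Tonelli Hamiltonians and Lagrangians\<close>

text \<open>
  Smoothness on the torus is smoothness of the lift to Euclidean space.
\<close>

definition second_derivative ::
  "('a::real_normed_vector \<Rightarrow> real) \<Rightarrow> ('a \<Rightarrow> 'a \<Rightarrow>\<^sub>L 'a \<Rightarrow>\<^sub>L real) \<Rightarrow> bool" where
  "second_derivative f f'' \<longleftrightarrow>
     (\<exists>f' :: 'a \<Rightarrow> 'a \<Rightarrow>\<^sub>L real.
        (\<forall>z. (f has_derivative blinfun_apply (f' z)) (at z)) \<and>
        (\<forall>z. (f' has_derivative blinfun_apply (f'' z)) (at z)))"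

definition tonelli :: "('n::finite torus \<Rightarrow> real ^ 'n \<Rightarrow> real) \<Rightarrow> bool" where
  "tonelli H \<longleftrightarrow>
     (\<exists>D2. second_derivative (\<lambda>(x, p). H (proj x) p) D2 \<and> continuous_on UNIV D2 \<and>
        (\<forall>x p w. w \<noteq> 0 \<longrightarrow> blinfun_apply (blinfun_apply (D2 (x, p)) (0, w)) (0, w) > 0)) \<and>
     (\<forall>K. \<exists>C. \<forall>x p. H x p \<ge> K * norm p - C)"

definition lagrangian ::
  "('n::finite torus \<Rightarrow> real ^ 'n \<Rightarrow> real) \<Rightarrow> 'n torus \<Rightarrow> real ^ 'n \<Rightarrow> real" where
  "lagrangian H x v = (SUP p. p \<bullet> v - H x p)"

definition C1_torus :: "('n::finite torus \<Rightarrow> real) \<Rightarrow> ('n torus \<Rightarrow> real ^ 'n) \<Rightarrow> bool" where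
  "C1_torus \<phi> D\<phi> \<longleftrightarrow>
     continuous_on UNIV D\<phi> \<and> (\<forall>x. GDERIV (\<lambda>y. \<phi> (proj y)) x :> D\<phi> (proj x))"

definition viscosity_solution ::
  "('n::finite torus \<Rightarrow> real ^ 'n \<Rightarrow> real) \<Rightarrow> real \<Rightarrow> ('n torus \<Rightarrow> real) \<Rightarrow> bool" where
  "viscosity_solution H c u \<longleftrightarrow>
     continuous_on UNIV u \<and>
     (\<forall>\<phi> D\<phi> x. C1_torus \<phi> D\<phi> \<longrightarrow>
        (\<forall>\<^sub>F y in nhds x. u y - \<phi> y \<le> u x - \<phi> x) \<longrightarrow> H x (D\<phi> x) \<le> c) \<and>
     (\<forall>\<phi> D\<phi> x. C1_torus \<phi> D\<phi> \<longrightarrow>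
        (\<forall>\<^sub>F y in nhds x. u y - \<phi> y \<ge> u x - \<phi> x) \<longrightarrow> H x (D\<phi> x) \<ge> c)"

definition critical_value :: "('n::finite torus \<Rightarrow> real ^ 'n \<Rightarrow> real) \<Rightarrow> real" where
  "critical_value H = (THE c. \<exists>u. viscosity_solution H c u)"

section \<open>Mather measures\<close>

definition borel_prob :: "'a::topological_space measure \<Rightarrow> bool" where
  "borel_prob \<mu> \<longleftrightarrow> prob_space \<mu> \<and> sets \<mu> = sets borel"

text \<open>
  Closedness includes that the integrals exist. Testing against
  \<open>sin (2 \<pi> x\<^sub>k)\<close> and \<open>cos (2 \<pi> x\<^sub>k)\<close> shows that this amounts to a finite first moment.
\<close>

definition closed_prob :: "('n::finite torus \<times> (real ^ 'n)) measure \<Rightarrow> bool" where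
  "closed_prob \<mu> \<longleftrightarrow>
     borel_prob \<mu> \<and>
     (\<forall>\<phi> D\<phi>. C1_torus \<phi> D\<phi> \<longrightarrow> has_bochner_integral \<mu> (\<lambda>(x, v). v \<bullet> D\<phi> x) 0)"

text \<open>
  Lagrangians are bounded below, so an integral (or a series, below) that does not converge
  absolutely has the value \<open>\<infinity>\<close>.
\<close>

definition action_integral ::
  "('n::finite torus \<Rightarrow> real ^ 'n \<Rightarrow> real) \<Rightarrow> ('n torus \<times> (real ^ 'n)) measure \<Rightarrow> ereal" where
  "action_integral L \<mu> =
     (if integrable \<mu> (\<lambda>(x, v). L x v) then ereal (LINT (x, v)|\<mu>. L x v) else \<infinity>)"

definition mather_measure ::
  "('n::finite torus \<Rightarrow> real ^ 'n \<Rightarrow> real) \<Rightarrow> ('n torus \<times> (real ^ 'n)) measure \<Rightarrow> bool" where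
  "mather_measure L \<mu> \<longleftrightarrow>
     closed_prob \<mu> \<and> (\<forall>\<mu>'. closed_prob \<mu>' \<longrightarrow> action_integral L \<mu> \<le> action_integral L \<mu>')"

definition spt :: "'a::topological_space measure \<Rightarrow> 'a set" where
  "spt \<mu> = {z. \<forall>U. open U \<longrightarrow> z \<in> U \<longrightarrow> emeasure \<mu> U > 0}"

definition mather_set ::
  "('n::finite torus \<Rightarrow> real ^ 'n \<Rightarrow> real) \<Rightarrow> ('n torus \<times> (real ^ 'n)) set" where
  "mather_set L = closure (\<Union>\<mu>\<in>{\<mu>. mather_measure L \<mu>}. spt \<mu>)"

definition narrow_conv ::
  "(nat \<Rightarrow> 'a::topological_space measure) \<Rightarrow> 'a measure \<Rightarrow> bool" where
  "narrow_conv \<nu> \<mu> \<longleftrightarrow>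
     (\<forall>f :: 'a \<Rightarrow> real. continuous_on UNIV f \<longrightarrow> bounded (range f) \<longrightarrow>
        (\<lambda>n. LINT z|\<nu> n. f z) \<longlonglongrightarrow> (LINT z|\<mu>. f z))"

section \<open>Discrete measures\<close>

definition mesh_size :: "real \<Rightarrow> bool" where
  "mesh_size h \<longleftrightarrow> (\<exists>N::nat. N \<ge> 1 \<and> h = 1 / real N)"

text \<open>Grid points are identified with their representatives in \<open>[0,1)\<^sup>d\<close>.\<close>

definition grid :: "real \<Rightarrow> (real ^ 'n::finite) set" where
  "grid h = {x. \<forall>k. \<exists>i::nat. x $ k = real i * h \<and> real i * h < 1}"

definition of_int_vec :: "int ^ 'n::finite \<Rightarrow> real ^ 'n" where
  "of_int_vec l = (\<chi> k. of_int (l $ k))"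

definition velocity :: "real \<Rightarrow> real ^ 'n::finite \<Rightarrow> real ^ 'n \<Rightarrow> int ^ 'n \<Rightarrow> real ^ 'n" where
  "velocity \<tau> x y l = (y + of_int_vec l - x) /\<^sub>R \<tau>"

text \<open>
  A family \<open>(\<mu>\<^sub>i\<^sub>j\<^sup>l)\<close> is a function of \<open>x\<^sub>i\<close>, \<open>x\<^sub>j\<close> and \<open>l\<close>; only its values
  on \<open>indices h\<close> matter.
\<close>

type_synonym 'n family = "real ^ 'n \<Rightarrow> real ^ 'n \<Rightarrow> int ^ 'n \<Rightarrow> real"

definition indices :: "real \<Rightarrow> ((real ^ 'n::finite) \<times> (real ^ 'n) \<times> (int ^ 'n)) set" where
  "indices h = grid h \<times> grid h \<times> UNIV"

text \<open>The time step does not enter the constraints defining \<open>\<H>\<^sub>h\<^sub>,\<^sub>\<tau>\<close>.\<close>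

definition holonomic :: "real \<Rightarrow> ('n::finite) family set" where
  "holonomic h = {\<mu>.
     (\<forall>(x, y, l)\<in>indices h. \<mu> x y l \<ge> 0) \<and>
     ((\<lambda>(x, y, l). \<mu> x y l) has_sum 1) (indices h) \<and>
     (\<forall>x\<in>grid h. (\<Sum>\<^sub>\<infinity>(y, l)\<in>grid h \<times> UNIV. \<mu> x y l) = (\<Sum>\<^sub>\<infinity>(y, l)\<in>grid h \<times> UNIV. \<mu> y x l))}"

text \<open>
  The reconstruction \<open>\<Sum> \<mu>\<^sub>i\<^sub>j\<^sup>l \<delta>\<close> is the image of the weighted counting measure on the indices.
\<close>

definition reconstruction ::
  "real \<Rightarrow> real \<Rightarrow> ('n::finite) family \<Rightarrow> ('n torus \<times> (real ^ 'n)) measure" where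
  "reconstruction h \<tau> \<mu> =
     distr (density (count_space (indices h)) (\<lambda>(x, y, l). ennreal (\<mu> x y l))) borel
       (\<lambda>(x, y, l). (proj x, velocity \<tau> x y l))"

definition discrete_action ::
  "('n::finite torus \<Rightarrow> real ^ 'n \<Rightarrow> real) \<Rightarrow> real \<Rightarrow> real \<Rightarrow> 'n family \<Rightarrow> ereal" where
  "discrete_action L h \<tau> \<mu> =
     (let f = (\<lambda>(x, y, l). L (proj x) (velocity \<tau> x y l) * \<mu> x y l)
      in if f summable_on indices h then ereal (infsum f (indices h)) else \<infinity>)"

definition discrete_min ::
  "('n::finite torus \<Rightarrow> real ^ 'n \<Rightarrow> real) \<Rightarrow> real \<Rightarrow> real \<Rightarrow> ereal" where
  "discrete_min L h \<tau> = (INF \<mu>\<in>holonomic h. discrete_action L h \<tau> \<mu>)"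

definition recovery_sequence ::
  "('n::finite torus \<Rightarrow> real ^ 'n \<Rightarrow> real) \<Rightarrow> (nat \<Rightarrow> real) \<Rightarrow> (nat \<Rightarrow> real) \<Rightarrow>
   ('n torus \<times> (real ^ 'n)) measure \<Rightarrow> (nat \<Rightarrow> 'n family) \<Rightarrow> bool" where
  "recovery_sequence H h \<tau> \<mu> \<nu> \<longleftrightarrow>
     (let L = lagrangian H; A = (\<lambda>n. discrete_action L (h n) (\<tau> n) (\<nu> n)) in
      (\<forall>n. \<nu> n \<in> holonomic (h n)) \<and>
      narrow_conv (\<lambda>n. reconstruction (h n) (\<tau> n) (\<nu> n)) \<mu> \<and>
      A \<longlonglongrightarrow> ereal (- critical_value H) \<and>
      (\<exists>C>0. \<forall>n. 0 \<le> A n - discrete_min L (h n) (\<tau> n) \<and>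
                 A n - discrete_min L (h n) (\<tau> n) \<le> ereal (C * (\<tau> n + h n / \<tau> n))))"

section \<open>Mass-threshold sets\<close>

definition near_minimizers ::
  "('n::finite torus \<Rightarrow> real ^ 'n \<Rightarrow> real) \<Rightarrow> real \<Rightarrow> real \<Rightarrow> real \<Rightarrow> 'n family set" where
  "near_minimizers L h \<tau> \<epsilon> =
     {\<mu> \<in> holonomic h. discrete_action L h \<tau> \<mu> \<le> discrete_min L h \<tau> + ereal \<epsilon>}"

definition cutoff :: "(real \<Rightarrow> real) \<Rightarrow> bool" where
  "cutoff \<kappa> \<longleftrightarrow>
     \<kappa> ` {0..} \<subseteq> {0..1} \<and> antimono_on {0..} \<kappa> \<and> (\<exists>K. K-lipschitz_on {0..} \<kappa>) \<and>
     (\<forall>s\<in>{0..1/2}. \<kappa> s = 1) \<and> (\<forall>s\<ge>1. \<kappa> s = 0)"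

definition smoothed_mass ::
  "(real \<Rightarrow> real) \<Rightarrow> 'a::metric_space measure \<Rightarrow> real \<Rightarrow> 'a \<Rightarrow> real" where
  "smoothed_mass \<kappa> \<nu> r z = (LINT w|\<nu>. \<kappa> (dist z w / r))"

definition max_mass ::
  "(real \<Rightarrow> real) \<Rightarrow> ('n::finite torus \<Rightarrow> real ^ 'n \<Rightarrow> real) \<Rightarrow> real \<Rightarrow> real \<Rightarrow> real \<Rightarrow> real \<Rightarrow>
   'n torus \<times> (real ^ 'n) \<Rightarrow> real" where
  "max_mass \<kappa> L h \<tau> \<epsilon> r z =
     (SUP \<mu>\<in>reconstruction h \<tau> ` near_minimizers L h \<tau> \<epsilon>. smoothed_mass \<kappa> \<mu> r z)"

definition mass_threshold_set ::
  "(real \<Rightarrow> real) \<Rightarrow> ('n::finite torus \<Rightarrow> real ^ 'n \<Rightarrow> real) \<Rightarrow> real \<Rightarrow> real \<Rightarrow> real \<Rightarrow> real \<Rightarrow> real \<Rightarrow>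
   ('n torus \<times> (real ^ 'n)) set" where
  "mass_threshold_set \<kappa> L h \<tau> \<epsilon> r \<delta> = {z. max_mass \<kappa> L h \<tau> \<epsilon> r z \<ge> \<delta>}"

end

(*
  Compactness of the Mather set: if a minimizing closed measure charged {|v| > R}, then replacing
  v by v/2 there and doubling the mass would give, after normalization, another closed measure.
  Comparing actions, 2 L(x, v/2) - L(x, v) has to be at least the minimal action on average over
  {|v| > R}; this fails for large R, because this quantity tends to -oo as |v| grows, by convexity
  and superlinearity. Since nearby centres have comparable cut-off functions, finitely many bumps
  centred in the Mather set then suffice, and narrow convergence gives them a uniform mass under
  the recovery sequence, which consists of near minimizers.
*)

theory Submission
  imports Defs
begin

section \<open>Topology of the torus\<close>

text \<open>Coordinatewise fractional parts give representatives in a compact cube; compactness in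
  the base variable comes from here.\<close>

lemma proj_unit_cube: "\<exists>x\<in>cbox 0 1. proj x = (a :: 'n::finite torus)"
proof -
  obtain y :: "real ^ 'n" where y: "proj y = a" using proj_surj by blast
  let ?x = "\<chi> k. frac (y $ k)"
  have "proj ?x = proj y"
    by (auto simp: proj_eq_iff frac_def)
  moreover have "?x \<in> cbox 0 1"
    by (auto simp: mem_box_cart less_imp_le[OF frac_lt_1])
  ultimately show ?thesis using y by metis
qed

lemma compact_UNIV_torus: "compact (UNIV :: 'n::finite torus set)"
proof -
  have "UNIV = proj ` (cbox 0 (1 :: real ^ 'n))"
    using proj_unit_cube by (metis UNIV_eq_I image_eqI)
  moreover have "compact (proj ` (cbox 0 (1 :: real ^ 'n)))"
    by (intro compact_continuous_image continuous_on_subset[OF continuous_proj]) auto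
  ultimately show ?thesis by metis
qed

text \<open>The torus carries the quotient topology of \<open>proj\<close>, so continuity may be
  tested on lifts, where the smoothness of \<open>H\<close> is formulated.\<close>

lemma continuous_on_torus:
  fixes f :: "'n::finite torus \<Rightarrow> 'b::topological_space"
  assumes "continuous_on UNIV (\<lambda>x. f (proj x))"
  shows "continuous_on UNIV f"
proof -
  have "open (f -` B)" if "open B" for B
    using open_vimage[OF that assms] by (simp add: open_torus_iff vimage_def)
  then show ?thesis by (simp add: continuous_on_open_vimage)
qed

section \<open>The Lagrangian\<close>

lemma tonelli_continuous_lift:
  assumes "tonelli (H :: 'n::finite torus \<Rightarrow> real ^ 'n \<Rightarrow> real)"
  shows "continuous_on UNIV (\<lambda>(x, p). H (proj x) p)"
proof -
  obtain f' :: "(real ^ 'n) \<times> (real ^ 'n) \<Rightarrow> ((real ^ 'n) \<times> (real ^ 'n)) \<Rightarrow>\<^sub>L real"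
    where "\<forall>z. ((\<lambda>(x, p). H (proj x) p) has_derivative blinfun_apply (f' z)) (at z)"
    using assms unfolding tonelli_def second_derivative_def by blast
  then show ?thesis
    by (intro has_derivative_continuous_on) (auto intro: has_derivative_at_withinI)
qed

lemma tonelli_continuous_left:
  assumes "tonelli (H :: 'n::finite torus \<Rightarrow> real ^ 'n \<Rightarrow> real)"
  shows "continuous_on UNIV (\<lambda>x. H x p)"
proof (rule continuous_on_torus)
  have "continuous_on UNIV ((\<lambda>(x, p). H (proj x) p) \<circ> (\<lambda>x. (x, p)))"
    by (intro continuous_on_compose continuous_intros
        continuous_on_subset[OF tonelli_continuous_lift[OF assms]]) auto
  then show "continuous_on UNIV (\<lambda>x. H (proj x) p)" by (simp add: comp_def)
qed

text \<open>Periodicity reduces \<open>x\<close> to the unit cube, so a continuous function on a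
  compact set is being bounded.\<close>

lemma tonelli_bounded_above:
  assumes "tonelli (H :: 'n::finite torus \<Rightarrow> real ^ 'n \<Rightarrow> real)"
  shows "\<exists>B. \<forall>x p. norm p \<le> K \<longrightarrow> H x p \<le> B"
proof -
  let ?f = "\<lambda>(x, p). H (proj x) p"
  let ?S = "cbox 0 (1 :: real ^ 'n) \<times> cball (0 :: real ^ 'n) K"
  have "compact (?f ` ?S)"
    by (intro compact_continuous_image continuous_on_subset[OF tonelli_continuous_lift[OF assms]]
        compact_Times) auto
  then obtain B where B: "\<And>y. y \<in> ?f ` ?S \<Longrightarrow> \<bar>y\<bar> \<le> B"
    using compact_imp_bounded bounded_iff by (metis real_norm_def)
  have "H x p \<le> B" if "norm p \<le> K" for x p
  proof -
    obtain y where "y \<in> cbox 0 1" "proj y = x" using proj_unit_cube by blast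
    then have "H x p \<in> ?f ` ?S" using that by (intro image_eqI[of _ _ "(y, p)"]) auto
    then show ?thesis using B by fastforce
  qed
  then show ?thesis by blast
qed

text \<open>Growth of \<open>H\<close> with slope \<open>norm v\<close> absorbs the inner product of
  \<open>p\<close> and \<open>v\<close> by Cauchy-Schwarz. Boundedness makes the real-valued
  \<open>SUP\<close> in \<open>lagrangian\<close> a genuine supremum.\<close>

lemma bdd_above_lagrangian:
  assumes "tonelli H"
  shows "bdd_above (range (\<lambda>p. p \<bullet> v - H x p))"
proof -
  obtain C where C: "\<And>x p. H x p \<ge> norm v * norm p - C"
    using assms unfolding tonelli_def by blast
  have "p \<bullet> v - H x p \<le> C" for p
    using C[of p x] norm_cauchy_schwarz[of p v] by (simp add: mult.commute)
  then show ?thesis by (intro bdd_aboveI) auto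
qed

lemma lagrangian_ge:
  assumes "tonelli H"
  shows "p \<bullet> v - H x p \<le> lagrangian H x v"
  unfolding lagrangian_def by (intro cSUP_upper bdd_above_lagrangian assms) auto

lemma lagrangian_superlinear:
  assumes "tonelli H"
  shows "\<exists>C. \<forall>x v. lagrangian H x v \<ge> K * norm v - C"
proof -
  obtain B where B: "\<And>x p. norm p \<le> \<bar>K\<bar> \<Longrightarrow> H x p \<le> B"
    using tonelli_bounded_above[OF assms] by blast
  have "lagrangian H x v \<ge> K * norm v - B" for x v
  proof -
    \<comment> \<open>Testing the supremum at this momentum produces the slope \<open>K\<close>. For
      \<open>v = 0\<close> it is the zero momentum, still within the radius on which
      \<open>B\<close> bounds \<open>H\<close>.\<close>
    let ?p = "K *\<^sub>R sgn v"
    have "sgn v \<bullet> v = norm v"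
      by (cases "v = 0") (simp_all add: sgn_div_norm dot_square_norm power2_eq_square)
    moreover have "norm ?p \<le> \<bar>K\<bar>" by (simp add: norm_sgn)
    ultimately show ?thesis
      using lagrangian_ge[OF assms, of ?p v x] B[of ?p x] by simp
  qed
  then show ?thesis by blast
qed

text \<open>Growth of \<open>H\<close> with the same slope \<open>K\<close> absorbs the inner
  product of \<open>p\<close> and \<open>v\<close> whenever \<open>norm v\<close> is at most
  \<open>K\<close>.\<close>

lemma lagrangian_bounded_above:
  assumes "tonelli H"
  shows "\<exists>B. \<forall>x v. norm v \<le> K \<longrightarrow> lagrangian H x v \<le> B"
proof -
  obtain C where C: "\<And>x p. H x p \<ge> K * norm p - C"
    using assms unfolding tonelli_def by blast
  have "lagrangian H x v \<le> C" if "norm v \<le> K" for x v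
    unfolding lagrangian_def
  proof (rule cSUP_least)
    fix p
    have "p \<bullet> v \<le> norm p * norm v" by (rule norm_cauchy_schwarz)
    also have "\<dots> \<le> K * norm p"
      using that by (metis mult.commute mult_left_mono norm_ge_zero)
    finally show "p \<bullet> v - H x p \<le> C" using C[of p x] by simp
  qed auto
  then show ?thesis by blast
qed

text \<open>For fixed \<open>x\<close> the Lagrangian is a supremum of functions affine in
  \<open>v\<close>.\<close>

lemma lagrangian_convex:
  assumes "tonelli H" and "0 \<le> t" "t \<le> 1"
  shows "lagrangian H x ((1 - t) *\<^sub>R u + t *\<^sub>R v)
    \<le> (1 - t) * lagrangian H x u + t * lagrangian H x v"
proof -
  have "p \<bullet> ((1 - t) *\<^sub>R u + t *\<^sub>R v) - H x p
      \<le> (1 - t) * lagrangian H x u + t * lagrangian H x v" for p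
  proof -
    have "(1 - t) * (p \<bullet> u - H x p) + t * (p \<bullet> v - H x p)
        \<le> (1 - t) * lagrangian H x u + t * lagrangian H x v"
      using assms by (intro add_mono mult_left_mono lagrangian_ge) auto
    then show ?thesis by (simp add: algebra_simps)
  qed
  then show ?thesis unfolding lagrangian_def[of H x "(1 - t) *\<^sub>R u + t *\<^sub>R v"]
    by (intro cSUP_least) auto
qed

text \<open>A supremum of functions continuous in \<open>(x, v)\<close> is lower semicontinuous: its
  strict superlevel sets are unions of open sets.\<close>

lemma borel_measurable_lagrangian:
  assumes "tonelli (H :: 'n::finite torus \<Rightarrow> real ^ 'n \<Rightarrow> real)"
  shows "(\<lambda>(x, v). lagrangian H x v) \<in> borel_measurable borel"
  unfolding borel_measurable_iff_greater
proof
  fix a :: real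
  have "continuous_on UNIV (\<lambda>z. p \<bullet> snd z - H (fst z) p)" for p
    by (intro continuous_intros continuous_on_compose2[OF tonelli_continuous_left[OF assms]]) auto
  then have "open {z. a < p \<bullet> snd z - H (fst z) p}" for p
    by (intro open_Collect_less continuous_on_const)
  moreover have "{z. a < (case z of (x, v) \<Rightarrow> lagrangian H x v)}
      = (\<Union>p. {z. a < p \<bullet> snd z - H (fst z) p})"
    unfolding lagrangian_def
    by (auto simp: less_cSUP_iff[OF _ bdd_above_lagrangian[OF assms]])
  ultimately show "{z \<in> space borel. a < (case z of (x, v) \<Rightarrow> lagrangian H x v)} \<in> sets borel"
    by (simp add: open_UN)
qed

text \<open>
  The left-hand side is the value at \<open>0\<close> of the secant of \<open>L x\<close> through \<open>v / 2\<close> and \<open>v\<close>,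
  a discrete version of minus the energy.
\<close>

lemma lagrangian_secant_intercept:
  assumes "tonelli H"
  shows "\<exists>R. \<forall>x v. norm v > R \<longrightarrow> 2 * lagrangian H x (v /\<^sub>R 2) - lagrangian H x v \<le> M"
proof -
  obtain B0 where B0: "\<And>x v. norm v \<le> 1 \<Longrightarrow> lagrangian H x v \<le> B0"
    using lagrangian_bounded_above[OF assms] by blast
  \<comment> \<open>The maximum makes \<open>B\<close> nonnegative, so that a surplus term
    \<open>B * s\<close> can be discarded at the end.\<close>
  define B where "B = max B0 0"
  have B: "lagrangian H x v \<le> B" if "norm v \<le> 1" for x v
    using B0[OF that, of x] by (simp add: B_def)
  \<comment> \<open>This slope beats \<open>s * B\<close> and the target \<open>M * (s - 1)\<close>
    together; the final \<open>1\<close> leaves a term \<open>s\<close> that dominates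
    \<open>C\<close>.\<close>
  define K where "K = 2 * B + \<bar>M\<bar> + 1"
  obtain C where C: "\<And>x v. lagrangian H x v \<ge> K * norm v - C"
    using lagrangian_superlinear[OF assms] by blast
  \<comment> \<open>The threshold yields \<open>s > 2\<close>, which makes \<open>t\<close>
    nonnegative, and also \<open>s > C\<close>.\<close>
  have "2 * lagrangian H x (v /\<^sub>R 2) - lagrangian H x v \<le> M" if v: "norm v > 2 + \<bar>C\<bar>" for x v
  proof -
    define s where "s = norm v"
    \<comment> \<open>The vector \<open>v /\<^sub>R 2\<close> lies on the segment from the unit
      vector \<open>sgn v\<close> to \<open>v\<close>; equating lengths,
      \<open>(1 - t) + t * s = s / 2\<close>, determines \<open>t\<close>.\<close>
    define t where "t = (s / 2 - 1) / (s - 1)"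
    have s: "s > 2 + \<bar>C\<bar>" using v by (simp add: s_def)
    have s1: "s - 1 > 0" and s0: "s > 0" using s by linarith+
    have ts: "t * (s - 1) = s / 2 - 1" using s1 by (simp add: t_def)
    have t0: "0 \<le> t" unfolding t_def using s by (intro divide_nonneg_nonneg) linarith+
    have t1: "t \<le> 1" unfolding t_def using s by (subst divide_le_eq_1_pos[OF s1]) linarith
    have "2 * (1 - t) * (s - 1) = 2 * (s - 1) - 2 * (t * (s - 1))"
      by (simp only: left_diff_distrib right_diff_distrib mult_1_right mult_1_left mult.assoc)
    then have st1: "2 * (1 - t) * (s - 1) = s" unfolding ts by simp
    have "(2 * t - 1) * (s - 1) = 2 * (t * (s - 1)) - (s - 1)"
      by (simp only: left_diff_distrib mult_1_left mult.assoc)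
    then have st2: "(2 * t - 1) * (s - 1) = - 1" unfolding ts by simp
    have "t * (s - 1) = t * s - t" by (simp only: right_diff_distrib mult_1_right)
    then have "(1 - t) + t * s = s / 2" using ts by linarith
    then have st3: "(1 - t) / s + t = 1 / 2" using s0 by (simp add: field_simps)
    have "sgn v = (1 / s) *\<^sub>R v" unfolding sgn_div_norm s_def by (simp only: inverse_eq_divide)
    then have "(1 - t) *\<^sub>R sgn v + t *\<^sub>R v = ((1 - t) / s + t) *\<^sub>R v"
      by (simp only: scaleR_add_left scaleR_scaleR times_divide_eq_right mult_1_right)
    then have "(1 - t) *\<^sub>R sgn v + t *\<^sub>R v = v /\<^sub>R 2"
      unfolding st3 by (simp only: inverse_eq_divide)
    then have "lagrangian H x (v /\<^sub>R 2)
        \<le> (1 - t) * lagrangian H x (sgn v) + t * lagrangian H x v"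
      using lagrangian_convex[OF assms t0 t1, of x "sgn v" v] by simp
    also have "\<dots> \<le> (1 - t) * B + t * lagrangian H x v"
      using t0 t1 by (intro add_right_mono mult_left_mono B) (auto simp: norm_sgn)
    finally have "2 * lagrangian H x (v /\<^sub>R 2) - lagrangian H x v
        \<le> 2 * (1 - t) * B + (2 * t - 1) * lagrangian H x v"
      by (simp add: algebra_simps)
    \<comment> \<open>Multiplying by \<open>s - 1\<close> clears the denominator of
      \<open>t\<close>: the coefficients \<open>2 * (1 - t)\<close> and \<open>2 * t - 1\<close>
      become \<open>s\<close> and \<open>-1\<close>. The value at \<open>v\<close> thus enters
      negatively, and superlinearity controls it.\<close>
    then have "(2 * lagrangian H x (v /\<^sub>R 2) - lagrangian H x v) * (s - 1)
        \<le> (2 * (1 - t) * B + (2 * t - 1) * lagrangian H x v) * (s - 1)"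
      using s by (intro mult_right_mono) auto
    also have "\<dots> = (2 * (1 - t) * (s - 1)) * B + ((2 * t - 1) * (s - 1)) * lagrangian H x v"
    proof -
      have "(a * b + c * l) * d = (a * d) * b + (c * d) * l" for a b c d l :: real
        by (simp add: algebra_simps)
      then show ?thesis .
    qed
    also have "\<dots> = s * B - lagrangian H x v" unfolding st1 st2 by simp
    also have "\<dots> \<le> s * B - (K * s - C)" using C[of v x] by (simp add: s_def)
    also have "\<dots> \<le> M * (s - 1)"
    proof -
      have "B \<ge> 0" by (simp add: B_def)
      then have "B * s \<ge> 0" using s by simp
      moreover have "\<bar>M\<bar> * s + M * (s - 1) \<ge> 0"
      proof -
        have "M * (s - 1) \<ge> - \<bar>M\<bar> * (s - 1)" using s1 by (intro mult_right_mono) linarith+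
        moreover have "\<bar>M\<bar> * s \<ge> \<bar>M\<bar> * (s - 1)" by (intro mult_left_mono) simp_all
        ultimately show ?thesis by linarith
      qed
      moreover have "K * s = 2 * (B * s) + \<bar>M\<bar> * s + s" by (simp add: K_def distrib_right)
      ultimately show ?thesis using s by (simp only: mult.commute[of s B])
    qed
    finally show ?thesis by (simp only: mult_le_cancel_right_pos[OF s1])
  qed
  then show ?thesis by blast
qed

section \<open>Mather measures\<close>

lemma borel_measurable_inner_C1:
  assumes "C1_torus \<phi> D\<phi>"
  shows "(\<lambda>(x, v). v \<bullet> D\<phi> x) \<in> borel_measurable borel"
proof -
  have "continuous_on UNIV D\<phi>" using assms unfolding C1_torus_def by blast
  then have "continuous_on UNIV (\<lambda>z. D\<phi> (fst z))"
    by (rule continuous_on_compose2) (intro continuous_intros, simp)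
  then have "continuous_on UNIV (\<lambda>z. snd z \<bullet> D\<phi> (fst z))"
    by (intro continuous_on_inner continuous_on_snd continuous_on_id)
  then show ?thesis
    unfolding case_prod_unfold by (rule borel_measurable_continuous_onI)
qed

text \<open>At zero velocity the integrand of the closedness condition vanishes. This supplies a
  competitor of finite action.\<close>

lemma closed_prob_return_zero: "closed_prob (return borel (a :: 'n::finite torus, 0))"
proof -
  have "has_bochner_integral (return borel (a, 0)) (\<lambda>(x, v). v \<bullet> D\<phi> x) 0"
    if "C1_torus \<phi> D\<phi>" for \<phi> and D\<phi> :: "'n torus \<Rightarrow> real ^ 'n"
  proof -
    note m = borel_measurable_inner_C1[OF that]
    have m': "(\<lambda>(x, v). v \<bullet> D\<phi> x) \<in> borel_measurable (return borel (a, 0))"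
      using m by simp
    have "integrable (return borel (a, 0)) (\<lambda>(x, v). v \<bullet> D\<phi> x)"
    proof (rule integrableI_bounded[OF m'])
      show "(\<integral>\<^sup>+ z. ennreal (norm (case z of (x, v) \<Rightarrow> v \<bullet> D\<phi> x)) \<partial>return borel (a, 0)) < \<infinity>"
        using m by (subst nn_integral_return) simp_all
    qed
    moreover have "(LINT z|return borel (a, 0). (case z of (x, v) \<Rightarrow> v \<bullet> D\<phi> x)) = 0"
      by (subst integral_return[OF _ m]) simp_all
    ultimately show ?thesis by (simp only: has_bochner_integral_iff)
  qed
  moreover have "prob_space (return borel (a, 0 :: real ^ 'n))" by (rule prob_space_return) simp
  ultimately show ?thesis
    unfolding closed_prob_def borel_prob_def by simp
qed

text \<open>Without integrability the action would be \<infinity> by convention, yet a minimizer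
  does at least as well as a Dirac mass at rest, whose action is finite.\<close>

lemma mather_measure_integrable:
  assumes "tonelli (H :: 'n::finite torus \<Rightarrow> real ^ 'n \<Rightarrow> real)" "mather_measure (lagrangian H) \<mu>"
  shows "integrable \<mu> (\<lambda>(x, v). lagrangian H x v)"
proof -
  let ?M = "return borel (proj 0 :: 'n torus, 0 :: real ^ 'n)"
  let ?L = "\<lambda>(x, v). lagrangian H x v"
  have m: "?L \<in> borel_measurable ?M"
    using borel_measurable_lagrangian[OF assms(1)] by simp
  have "integrable ?M ?L"
    using m by (intro integrableI_bounded) (auto simp: nn_integral_return)
  then have "action_integral (lagrangian H) ?M < \<infinity>"
    by (simp add: action_integral_def)
  moreover have "action_integral (lagrangian H) \<mu> \<le> action_integral (lagrangian H) ?M"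
    using assms(2) closed_prob_return_zero unfolding mather_measure_def by blast
  ultimately show ?thesis
    by (auto simp: action_integral_def split: if_splits)
qed

text \<open>
  The measure \<open>\<mu>'\<close> moves the mass in \<open>S\<close> at half speed for twice the time, which does not
  change the integrals \<open>\<integral> v \<bullet> D\<phi>\<close>.
\<close>

lemma closed_prob_slow_down:
  fixes \<mu> :: "('n::finite torus \<times> (real ^ 'n)) measure"
  assumes "closed_prob \<mu>" and S[measurable]: "S \<in> sets borel"
  obtains \<mu>' where "closed_prob \<mu>'"
    and "\<And>f. f \<in> borel_measurable borel \<Longrightarrow>
      integrable \<mu> (\<lambda>z. if z \<in> S then 2 * f (fst z, snd z /\<^sub>R 2) else f z) \<Longrightarrow>
      has_bochner_integral \<mu>' f
        ((LINT z|\<mu>. (if z \<in> S then 2 * f (fst z, snd z /\<^sub>R 2) else f z)) / (1 + measure \<mu> S))"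
proof -
  interpret prob_space \<mu> using assms by (simp add: closed_prob_def borel_prob_def)
  have sets[measurable_cong, simp]: "sets \<mu> = sets borel"
    using assms by (simp add: closed_prob_def borel_prob_def)
  have space[simp]: "space \<mu> = UNIV" using sets_eq_imp_space_eq[OF sets] by simp
  \<comment> \<open>Doubling the mass on \<open>S\<close> raises the total from 1 to
    \<open>1 + measure \<mu> S\<close>; \<open>c\<close> is the normalizing constant.\<close>
  define c where "c = 1 + measure \<mu> S"
  have c: "c > 0" unfolding c_def by (simp add: add_pos_nonneg)
  define T where "T = (\<lambda>z :: 'n torus \<times> (real ^ 'n). if z \<in> S then (fst z, snd z /\<^sub>R 2) else z)"
  define w where "w = (\<lambda>z :: 'n torus \<times> (real ^ 'n). (if z \<in> S then 2 else 1) / c)"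
  have "continuous_on UNIV (\<lambda>z :: 'n torus \<times> (real ^ 'n). (fst z, snd z /\<^sub>R 2))"
    by (intro continuous_intros)
  then have [measurable]: "(\<lambda>z :: 'n torus \<times> (real ^ 'n). (fst z, snd z /\<^sub>R 2)) \<in> borel \<rightarrow>\<^sub>M borel"
    by (rule borel_measurable_continuous_onI)
  have T[measurable]: "T \<in> borel \<rightarrow>\<^sub>M borel" unfolding T_def by measurable
  have w[measurable]: "w \<in> borel_measurable borel" unfolding w_def by measurable
  have w0: "w z \<ge> 0" for z using c by (simp add: w_def)
  define \<mu>' where "\<mu>' = distr (density \<mu> (\<lambda>z. ennreal (w z))) borel T"
  have int: "has_bochner_integral \<mu>' f
        ((LINT z|\<mu>. (if z \<in> S then 2 * f (fst z, snd z /\<^sub>R 2) else f z)) / c)"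
    if f[measurable]: "f \<in> borel_measurable borel"
      and i: "integrable \<mu> (\<lambda>z. if z \<in> S then 2 * f (fst z, snd z /\<^sub>R 2) else f z)" for f
  proof -
    have eq: "w z *\<^sub>R f (T z) = (if z \<in> S then 2 * f (fst z, snd z /\<^sub>R 2) else f z) / c" for z
      by (simp add: w_def T_def)
    have "has_bochner_integral \<mu> (\<lambda>z. w z *\<^sub>R f (T z))
        ((LINT z|\<mu>. (if z \<in> S then 2 * f (fst z, snd z /\<^sub>R 2) else f z)) / c)"
      unfolding eq using has_bochner_integral_integrable[OF i]
      by (rule has_bochner_integral_divide_zero[rotated])
    then show ?thesis
      unfolding \<mu>'_def using w0
      by (intro has_bochner_integral_distr has_bochner_integral_density) auto
  qed
  \<comment> \<open>The total mass comes from the integral formula just proved, applied to the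
    constant function 1.\<close>
  have "has_bochner_integral \<mu>' (\<lambda>_. 1) (1 :: real)"
  proof -
    have eq: "(if z \<in> S then 2 * 1 else 1) = 1 + indicat_real S z" for z by simp
    have i: "integrable \<mu> (\<lambda>z. if z \<in> S then 2 * 1 else 1 :: real)"
      unfolding eq
      by (intro Bochner_Integration.integrable_add integrable_real_indicator)
        (auto simp: emeasure_eq_measure)
    moreover have "(LINT z|\<mu>. (if z \<in> S then 2 * 1 else 1)) = c"
      unfolding eq c_def using prob_space
      by (subst Bochner_Integration.integral_add)
        (auto simp: emeasure_eq_measure intro: integrable_real_indicator)
    ultimately show ?thesis using int[of "\<lambda>_. 1"] c by simp
  qed
  then have "measure \<mu>' (space \<mu>') = 1"
    using has_bochner_integral_integral_eq by fastforce
  \<comment> \<open>Infinite total mass is excluded because \<open>measure\<close> would then be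
    0.\<close>
  then have "prob_space \<mu>'"
    by (metis Sigma_Algebra.measure_def emeasure_eq_ennreal_measure enn2real_top ennreal_1
        prob_spaceI zero_neq_one)
  moreover have "has_bochner_integral \<mu>' (\<lambda>(x, v). v \<bullet> D\<phi> x) 0"
    if \<phi>: "C1_torus \<phi> D\<phi>" for \<phi> D\<phi>
  proof -
    note m = borel_measurable_inner_C1[OF \<phi>]
    have eq: "(if z \<in> S then 2 * (case (fst z, snd z /\<^sub>R 2) of (x, v) \<Rightarrow> v \<bullet> D\<phi> x)
        else (case z of (x, v) \<Rightarrow> v \<bullet> D\<phi> x)) = (case z of (x, v) \<Rightarrow> v \<bullet> D\<phi> x)" for z
      by (auto split: prod.splits)
    have "has_bochner_integral \<mu> (\<lambda>(x, v). v \<bullet> D\<phi> x) 0"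
      using assms(1) \<phi> unfolding closed_prob_def by blast
    then show ?thesis
      using int[OF m] unfolding eq by (simp add: has_bochner_integral_iff)
  qed
  moreover have "sets \<mu>' = sets borel" by (simp add: \<mu>'_def)
  ultimately have "closed_prob \<mu>'"
    by (auto simp: closed_prob_def borel_prob_def)
  then show ?thesis using int that unfolding c_def by blast
qed

text \<open>Before normalization, slowing down velocities beyond \<open>R\<close> changes the action
  by the integral of \<open>2 * L(x, v/2) - L(x, v)\<close> over them and adds their measure to the
  total mass. Each unit of added mass costs at most \<open>A - 1\<close>, less than the average
  \<open>A\<close>, so a minimizer cannot charge such velocities.\<close>

lemma mather_measure_bounded_velocity:
  assumes H: "tonelli (H :: 'n::finite torus \<Rightarrow> real ^ 'n \<Rightarrow> real)"
    and \<mu>: "mather_measure (lagrangian H) \<mu>"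
  shows "\<exists>R. emeasure \<mu> {z. norm (snd z) > R} = 0"
proof -
  let ?L = "\<lambda>(x, v). lagrangian H x v"
  have cl: "closed_prob \<mu>" using \<mu> by (simp add: mather_measure_def)
  interpret prob_space \<mu> using cl by (simp add: closed_prob_def borel_prob_def)
  have sets[measurable_cong, simp]: "sets \<mu> = sets borel"
    using cl by (simp add: closed_prob_def borel_prob_def)
  have space[simp]: "space \<mu> = UNIV" using sets_eq_imp_space_eq[OF sets] by simp
  have iL: "integrable \<mu> ?L" by (rule mather_measure_integrable[OF H \<mu>])
  define A where "A = (LINT z|\<mu>. ?L z)"
  \<comment> \<open>The margin 1 below the action \<open>A\<close> is what makes the final
    comparison strict.\<close>
  obtain R where R: "\<And>x v. norm v > R \<Longrightarrow>
      2 * lagrangian H x (v /\<^sub>R 2) - lagrangian H x v \<le> A - 1"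
    using lagrangian_secant_intercept[OF H] by metis
  obtain C where C: "\<And>x v. lagrangian H x v \<ge> - C"
    using lagrangian_superlinear[OF H, of 0] by auto
  define S where "S = {z :: 'n torus \<times> (real ^ 'n). norm (snd z) > R}"
  have "open S" unfolding S_def by (intro open_Collect_less continuous_intros)
  then have S[measurable]: "S \<in> sets borel" by simp
  define g where "g = (\<lambda>z. if z \<in> S then 2 * ?L (fst z, snd z /\<^sub>R 2) else ?L z)"
  have L[measurable]: "?L \<in> borel_measurable borel" by (rule borel_measurable_lagrangian[OF H])
  have "continuous_on UNIV (\<lambda>z :: 'n torus \<times> (real ^ 'n). (fst z, snd z /\<^sub>R 2))"
    by (intro continuous_intros)
  then have half: "(\<lambda>z :: 'n torus \<times> (real ^ 'n). (fst z, snd z /\<^sub>R 2)) \<in> borel \<rightarrow>\<^sub>M borel"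
    by (rule borel_measurable_continuous_onI)
  have [measurable]: "(\<lambda>z. ?L (fst z, snd z /\<^sub>R 2)) \<in> borel_measurable borel"
    by (rule measurable_compose[OF half L])
  have [measurable]: "g \<in> borel_measurable borel" unfolding g_def by measurable
  have g_le: "g z \<le> ?L z + (A - 1) * indicat_real S z" for z
    using R[of "snd z" "fst z"] by (auto simp: g_def S_def case_prod_unfold)
  have g_ge: "g z \<ge> - 2 * \<bar>C\<bar>" for z
    using C[of "fst z" "snd z /\<^sub>R 2"] C[of "fst z" "snd z"] by (auto simp: g_def case_prod_unfold)
  have iU: "integrable \<mu> (\<lambda>z. ?L z + (A - 1) * indicat_real S z)"
    by (intro Bochner_Integration.integrable_add iL integrable_mult_right integrable_real_indicator)
      (auto simp: emeasure_eq_measure)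
  \<comment> \<open>Integrability follows by squeezing \<open>g\<close> between a constant and an
    integrable function.\<close>
  have ig: "integrable \<mu> g"
  proof (rule Bochner_Integration.integrable_bound)
    show "integrable \<mu> (\<lambda>z. \<bar>?L z + (A - 1) * indicat_real S z\<bar> + 2 * \<bar>C\<bar>)"
      by (intro Bochner_Integration.integrable_add integrable_abs iU) auto
    show "AE z in \<mu>. norm (g z) \<le> norm (\<bar>?L z + (A - 1) * indicat_real S z\<bar> + 2 * \<bar>C\<bar>)"
    proof (rule AE_I2)
      fix z
      show "norm (g z) \<le> norm (\<bar>?L z + (A - 1) * indicat_real S z\<bar> + 2 * \<bar>C\<bar>)"
        using g_le[of z] g_ge[of z] unfolding real_norm_def by linarith
    qed
  qed measurable
  define c where "c = 1 + measure \<mu> S"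
  obtain \<mu>' where \<mu>': "closed_prob \<mu>'" "has_bochner_integral \<mu>' ?L ((LINT z|\<mu>. g z) / c)"
  proof (rule closed_prob_slow_down[OF cl S])
    fix \<mu>'
    assume "closed_prob \<mu>'" and int: "\<And>f. f \<in> borel_measurable borel \<Longrightarrow>
        integrable \<mu> (\<lambda>z. if z \<in> S then 2 * f (fst z, snd z /\<^sub>R 2) else f z) \<Longrightarrow>
        has_bochner_integral \<mu>' f
          ((LINT z|\<mu>. (if z \<in> S then 2 * f (fst z, snd z /\<^sub>R 2) else f z)) / (1 + measure \<mu> S))"
    then show thesis
      using that[of \<mu>'] int[OF L] ig unfolding g_def c_def by blast
  qed
  have "action_integral (lagrangian H) \<mu> \<le> action_integral (lagrangian H) \<mu>'"
    using \<mu> \<mu>'(1) unfolding mather_measure_def by blast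
  then have "A \<le> (LINT z|\<mu>. g z) / c"
    using iL \<mu>'(2) by (simp add: action_integral_def A_def has_bochner_integral_iff)
  moreover have "c > 0" unfolding c_def by (simp add: add_pos_nonneg)
  ultimately have "A * c \<le> (LINT z|\<mu>. g z)" by (simp add: field_simps)
  also have "\<dots> \<le> (LINT z|\<mu>. ?L z + (A - 1) * indicat_real S z)"
    by (rule integral_mono[OF ig iU g_le])
  also have "\<dots> = A + (A - 1) * measure \<mu> S"
    unfolding A_def
    by (subst Bochner_Integration.integral_add[OF iL])
      (auto simp: emeasure_eq_measure intro!: integrable_real_indicator)
  \<comment> \<open>Since \<open>c = 1 + measure \<mu> S\<close>, the ends of the chain are
    \<open>A + A * measure \<mu> S\<close> and \<open>A + (A - 1) * measure \<mu> S\<close>.\<close>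
  finally have "measure \<mu> S \<le> 0" by (simp add: c_def algebra_simps)
  then have "emeasure \<mu> S = 0" by (simp add: emeasure_eq_measure measure_le_0_iff)
  then show ?thesis unfolding S_def by blast
qed

text \<open>The velocity bound of the single measure \<open>\<mu>\<close> passes to the whole Mather
  set, which is its support. The Mather set is then a closed subset of the torus times a
  ball.\<close>

lemma compact_full_support:
  assumes H: "tonelli (H :: 'n::finite torus \<Rightarrow> real ^ 'n \<Rightarrow> real)"
    and \<mu>: "mather_measure (lagrangian H) \<mu>" "spt \<mu> = mather_set (lagrangian H)"
  shows "compact (mather_set (lagrangian H))"
proof -
  obtain R where R: "emeasure \<mu> {z. norm (snd z) > R} = 0"
    using mather_measure_bounded_velocity[OF H \<mu>(1)] by blast
  have "open {z :: 'n torus \<times> (real ^ 'n). norm (snd z) > R}"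
    by (intro open_Collect_less continuous_intros)
  then have "spt \<mu> \<subseteq> {z. norm (snd z) \<le> R}"
    using R unfolding spt_def by force
  then have "mather_set (lagrangian H) \<subseteq> UNIV \<times> cball 0 R"
    using \<mu>(2) by auto
  moreover have "compact ((UNIV :: 'n torus set) \<times> cball (0 :: real ^ 'n) R)"
    by (intro compact_Times compact_UNIV_torus compact_cball)
  moreover have "closed (mather_set (lagrangian H))" by (simp add: mather_set_def)
  ultimately show ?thesis by (metis compact_Int_closed inf.absorb_iff2)
qed

section \<open>Discrete measures\<close>

text \<open>Nonnegative weights of sum 1 form a probability density for the counting measure, and
  the reconstruction is an image of the resulting measure.\<close>

lemma borel_prob_reconstruction:
  assumes "\<nu> \<in> holonomic h"
  shows "borel_prob (reconstruction h \<tau> (\<nu> :: 'n::finite family))"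
proof -
  let ?f = "\<lambda>(x, y, l). \<nu> x y l"
  have pos: "?f i \<ge> 0" if "i \<in> indices h" for i
    using assms that unfolding holonomic_def by auto
  have hs: "(?f has_sum 1) (indices h)" using assms unfolding holonomic_def by blast
  then have "?f summable_on indices h" by (rule has_sum_imp_summable)
  \<comment> \<open>Summable real families are absolutely summable, which lets the sum be read as an
    integral over the counting measure.\<close>
  then have abs: "Infinite_Set_Sum.abs_summable_on ?f (indices h)"
    by (simp only: abs_summable_equivalent summable_on_iff_abs_summable_on_real)
  have "(\<integral>\<^sup>+ i. ennreal (?f i) \<partial>count_space (indices h)) = ennreal (infsetsum ?f (indices h))"
    using nn_integral_conv_infsetsum[OF abs pos] by simp
  also have "\<dots> = 1"
    using infsetsum_infsum[OF abs] infsumI[OF hs] by simp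
  finally have i1: "(\<integral>\<^sup>+ i. ennreal (?f i) \<partial>count_space (indices h)) = 1" .
  let ?D = "density (count_space (indices h)) (\<lambda>(x, y, l). ennreal (\<nu> x y l))"
  have "emeasure ?D (space ?D)
      = (\<integral>\<^sup>+ i. ennreal (?f i) * indicator (indices h) i \<partial>count_space (indices h))"
    by (simp add: emeasure_density case_prod_unfold)
  also have "\<dots> = (\<integral>\<^sup>+ i. ennreal (?f i) \<partial>count_space (indices h))"
    by (intro nn_integral_cong) simp
  finally have "prob_space ?D" unfolding i1 by (rule prob_spaceI)
  then have "prob_space (reconstruction h \<tau> \<nu>)"
    unfolding reconstruction_def by (rule prob_space.prob_space_distr) simp
  then show ?thesis by (simp add: borel_prob_def reconstruction_def)
qed

section \<open>Cut-off functions, smoothed masses and their uniform lower bounds\<close>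

lemma cutoff_continuous:
  assumes "cutoff \<kappa>" "s > 0"
  shows "continuous_on UNIV (\<lambda>w. \<kappa> (dist z w / s))"
proof -
  obtain K where "K-lipschitz_on {0..} \<kappa>" using assms unfolding cutoff_def by blast
  then have "continuous_on {0..} \<kappa>" by (rule lipschitz_on_continuous_on)
  then show ?thesis
    by (rule continuous_on_compose2) (use assms(2) in \<open>auto intro!: continuous_intros\<close>)
qed

lemma cutoff_bounds:
  assumes "cutoff \<kappa>" "s \<ge> 0"
  shows "0 \<le> \<kappa> s" "\<kappa> s \<le> 1"
  using assms unfolding cutoff_def by (auto simp: image_subset_iff)

lemma integrable_cutoff:
  assumes "cutoff \<kappa>" "s > 0" "borel_prob \<mu>"
  shows "integrable \<mu> (\<lambda>w. \<kappa> (dist z w / s))"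
proof -
  interpret prob_space \<mu> using assms by (simp add: borel_prob_def)
  have "(\<lambda>w. \<kappa> (dist z w / s)) \<in> borel_measurable \<mu>"
    using borel_measurable_continuous_onI[OF cutoff_continuous[OF assms(1,2)]] assms(3)
    by (simp add: borel_prob_def cong: measurable_cong_sets)
  moreover have "AE w in \<mu>. norm (\<kappa> (dist z w / s)) \<le> 1"
    using cutoff_bounds[OF assms(1)] assms(2) by (intro AE_I2) auto
  ultimately show ?thesis by (intro integrable_const_bound)
qed

lemma smoothed_mass_le_1:
  assumes "cutoff \<kappa>" "s > 0" "borel_prob \<mu>"
  shows "smoothed_mass \<kappa> \<mu> s z \<le> 1"
proof -
  interpret prob_space \<mu> using assms by (simp add: borel_prob_def)
  have "smoothed_mass \<kappa> \<mu> s z \<le> (LINT w|\<mu>. 1)"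
    unfolding smoothed_mass_def using cutoff_bounds[OF assms(1)] assms(2)
    by (intro integral_mono integrable_cutoff[OF assms]) auto
  then show ?thesis by (simp add: prob_space)
qed

text \<open>The comparison is pointwise. The narrow bump at \<open>z'\<close> vanishes at distance
  \<open>r / 4\<close> and beyond; closer in, the triangle inequality gives distance at most
  \<open>r / 2\<close> from \<open>z\<close>, where the wide bump equals 1.\<close>

lemma smoothed_mass_recentre:
  assumes "cutoff \<kappa>" "r > 0" "borel_prob \<mu>" "dist z' z \<le> r / 4"
  shows "smoothed_mass \<kappa> \<mu> (r / 4) z' \<le> smoothed_mass \<kappa> \<mu> r z"
  unfolding smoothed_mass_def
proof (rule integral_mono)
  show "integrable \<mu> (\<lambda>w. \<kappa> (dist z' w / (r / 4)))" "integrable \<mu> (\<lambda>w. \<kappa> (dist z w / r))"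
    using assms by (intro integrable_cutoff; simp)+
  fix w
  show "\<kappa> (dist z' w / (r / 4)) \<le> \<kappa> (dist z w / r)"
  proof (cases "dist z' w \<le> r / 4")
    case True
    then have "dist z w \<le> r / 2"
      using assms(4) dist_triangle[of z w z'] by (simp add: dist_commute)
    then have "dist z w / r \<in> {0..1/2}" using assms(2) by (simp add: field_simps)
    then have "\<kappa> (dist z w / r) = 1" using assms(1) unfolding cutoff_def by blast
    then show ?thesis using cutoff_bounds(2)[OF assms(1)] assms(2) by simp
  next
    case False
    then have "dist z' w / (r / 4) \<ge> 1" using assms(2) by (simp add: field_simps)
    then have "\<kappa> (dist z' w / (r / 4)) = 0" using assms(1) unfolding cutoff_def by blast
    then show ?thesis using cutoff_bounds(1)[OF assms(1)] assms(2) by simp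
  qed
qed

text \<open>The bump dominates the indicator of the ball of radius \<open>s / 2\<close>, which has
  positive measure around a point of the support.\<close>

lemma smoothed_mass_pos:
  assumes "cutoff \<kappa>" "s > 0" "borel_prob \<mu>" "z \<in> spt \<mu>"
  shows "smoothed_mass \<kappa> \<mu> s z > 0"
proof -
  interpret prob_space \<mu> using assms by (simp add: borel_prob_def)
  have sets[simp]: "sets \<mu> = sets borel" using assms by (simp add: borel_prob_def)
  let ?B = "ball z (s / 2)"
  have "emeasure \<mu> ?B > 0" using assms(2,4) unfolding spt_def by simp
  then have "0 < measure \<mu> ?B" by (simp add: emeasure_eq_measure)
  also have "\<dots> = (LINT w|\<mu>. indicat_real ?B w)" using sets_eq_imp_space_eq[OF sets] by simp
  also have "\<dots> \<le> smoothed_mass \<kappa> \<mu> s z"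
    unfolding smoothed_mass_def
  proof (rule integral_mono)
    fix w
    show "indicat_real ?B w \<le> \<kappa> (dist z w / s)"
    proof (cases "w \<in> ?B")
      case True
      then have "dist z w / s \<in> {0..1/2}" using assms(2) by (simp add: field_simps)
      then have "\<kappa> (dist z w / s) = 1" using assms(1) unfolding cutoff_def by blast
      then show ?thesis by simp
    qed (use cutoff_bounds(1)[OF assms(1)] assms(2) in simp)
  qed (auto intro!: integrable_cutoff[OF assms(1-3)] integrable_real_indicator
      simp: emeasure_eq_measure)
  finally show ?thesis .
qed

text \<open>The real supremum dominates its members because smoothed masses of probability measures
  are bounded by 1.\<close>

lemma max_mass_ge:
  assumes "cutoff \<kappa>" "r > 0" "\<nu> \<in> near_minimizers L h \<tau> \<epsilon>"
  shows "smoothed_mass \<kappa> (reconstruction h \<tau> \<nu>) r z \<le> max_mass \<kappa> L h \<tau> \<epsilon> r z"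
  unfolding max_mass_def
proof (rule cSUP_upper)
  show "bdd_above ((\<lambda>\<mu>. smoothed_mass \<kappa> \<mu> r z) ` reconstruction h \<tau> ` near_minimizers L h \<tau> \<epsilon>)"
    by (intro bdd_aboveI2[of _ _ 1])
      (auto simp: near_minimizers_def
        intro!: smoothed_mass_le_1[OF assms(1,2)] borel_prob_reconstruction)
qed (use assms(3) in auto)

text \<open>Narrow convergence handles one bump at a time. A finite \<open>r / 4\<close>-net of
  \<open>M\<close> makes the bound simultaneous, and recentring extends it from the net to all of
  \<open>M\<close>.\<close>

lemma compact_eventually_smoothed_mass:
  fixes M :: "'a::metric_space set"
  assumes "cutoff \<kappa>" "r > 0" "compact M" "M \<subseteq> spt \<mu>" "borel_prob \<mu>"
    and "\<And>n. borel_prob (\<nu> n)" "narrow_conv \<nu> \<mu>"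
  shows "\<exists>\<delta>>0. \<delta> \<le> 1 \<and> (\<forall>\<^sub>F n in sequentially. \<forall>z\<in>M. \<delta> \<le> smoothed_mass \<kappa> (\<nu> n) r z)"
proof -
  obtain F where F: "F \<subseteq> M" "finite F" "M \<subseteq> (\<Union>z\<in>F. ball z (r / 4))"
    using compactE_image[OF assms(3), of M "\<lambda>z. ball z (r / 4)"] assms(2) by force
  define m where "m z = smoothed_mass \<kappa> \<mu> (r / 4) z" for z
  have m: "m z > 0" if "z \<in> F" for z
    unfolding m_def using that F(1) assms by (intro smoothed_mass_pos) auto
  \<comment> \<open>Halving the limit masses leaves room for a strict inequality before the limit.
    The inserted 1 ensures \<open>\<delta> \<le> 1\<close> and keeps the set nonempty when
    \<open>F\<close> is empty.\<close>
  define \<delta> where "\<delta> = Min (insert 1 ((\<lambda>z. m z / 2) ` F))"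
  have \<delta>: "\<delta> > 0" "\<delta> \<le> 1"
    unfolding \<delta>_def using F(2) m by (auto simp: Min_gr_iff)
  have \<delta>_le: "\<delta> \<le> m z / 2" if "z \<in> F" for z
    unfolding \<delta>_def using F(2) that by (intro Min_le) auto
  have "\<forall>\<^sub>F n in sequentially. \<delta> < smoothed_mass \<kappa> (\<nu> n) (r / 4) z" if "z \<in> F" for z
  proof -
    have r4: "r / 4 > 0" using assms(2) by simp
    have "bounded (range (\<lambda>w. \<kappa> (dist z w / (r / 4))))"
      unfolding bounded_iff using cutoff_bounds[OF assms(1)] assms(2)
      by (intro exI[of _ 1]) auto
    then have "(\<lambda>n. smoothed_mass \<kappa> (\<nu> n) (r / 4) z) \<longlonglongrightarrow> m z"
      using assms(7) cutoff_continuous[OF assms(1) r4]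
      unfolding narrow_conv_def smoothed_mass_def m_def by blast
    moreover have "\<delta> < m z" using \<delta>_le[OF that] m[OF that] by simp
    ultimately show ?thesis by (rule order_tendstoD)
  qed
  then have "\<forall>\<^sub>F n in sequentially. \<forall>z\<in>F. \<delta> < smoothed_mass \<kappa> (\<nu> n) (r / 4) z"
    using F(2) by (simp add: eventually_ball_finite)
  then have "\<forall>\<^sub>F n in sequentially. \<forall>z\<in>M. \<delta> \<le> smoothed_mass \<kappa> (\<nu> n) r z"
  proof eventually_elim
    case (elim n)
    show ?case
    proof
      fix z assume "z \<in> M"
      then obtain z' where z': "z' \<in> F" "dist z' z < r / 4" using F(3) by auto
      then show "\<delta> \<le> smoothed_mass \<kappa> (\<nu> n) r z"
        using elim smoothed_mass_recentre[OF assms(1,2) assms(6)[of n], of z' z] by fastforce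
    qed
  qed
  then show ?thesis using \<delta> by blast
qed

theorem proposition6p6:
  fixes H :: "'n::finite torus \<Rightarrow> real ^ 'n \<Rightarrow> real"
    and \<kappa> :: "real \<Rightarrow> real"
    and h \<tau> \<epsilon> :: "nat \<Rightarrow> real"
    and \<mu> :: "('n torus \<times> (real ^ 'n)) measure"
    and \<nu> :: "nat \<Rightarrow> 'n family"
    and L :: "'n torus \<Rightarrow> real ^ 'n \<Rightarrow> real"
    and \<eta> :: "nat \<Rightarrow> ereal"
  assumes "tonelli H"
    and "L = lagrangian H"
    and "cutoff \<kappa>"
    and "\<forall>n. mesh_size (h n)"
    and "\<forall>n. \<tau> n > 0"
    and "\<tau> \<longlonglongrightarrow> 0"
    and "h \<longlonglongrightarrow> 0"
    and "(\<lambda>n. h n / \<tau> n) \<longlonglongrightarrow> 0"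
    and "mather_measure L \<mu>"
    and "spt \<mu> = mather_set L"
    and "recovery_sequence H h \<tau> \<mu> \<nu>"
    and "\<forall>n. \<eta> n = discrete_action L (h n) (\<tau> n) (\<nu> n) - discrete_min L (h n) (\<tau> n)"
    and "\<epsilon> \<longlonglongrightarrow> 0"
    and "\<forall>\<^sub>F n in sequentially. \<eta> n \<le> ereal (\<epsilon> n)"
  shows "\<forall>r>0. \<exists>\<delta>>0. \<delta> \<le> 1 \<and>
           (\<forall>\<^sub>F n in sequentially. mather_set L \<subseteq> mass_threshold_set \<kappa> L (h n) (\<tau> n) (\<epsilon> n) r \<delta>)"
proof (intro allI impI)
  fix r :: real
  assume r: "r > 0"
  let ?\<nu> = "\<lambda>n. reconstruction (h n) (\<tau> n) (\<nu> n)"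
  have hol: "\<nu> n \<in> holonomic (h n)" for n
    using assms(11) by (auto simp: recovery_sequence_def Let_def)
  have "narrow_conv ?\<nu> \<mu>"
    using assms(11) by (auto simp: recovery_sequence_def Let_def)
  moreover have "borel_prob \<mu>"
    using assms(9) by (simp add: mather_measure_def closed_prob_def)
  moreover have "compact (mather_set L)"
    using compact_full_support assms(1,2,9,10) by blast
  ultimately obtain \<delta> where \<delta>: "\<delta> > 0" "\<delta> \<le> 1"
      "\<forall>\<^sub>F n in sequentially. \<forall>z\<in>mather_set L. \<delta> \<le> smoothed_mass \<kappa> (?\<nu> n) r z"
    using compact_eventually_smoothed_mass[OF assms(3) r, of "mather_set L" \<mu> ?\<nu>]
      borel_prob_reconstruction[OF hol] assms(10) by blast
  have "\<forall>\<^sub>F n in sequentially. mather_set L \<subseteq> mass_threshold_set \<kappa> L (h n) (\<tau> n) (\<epsilon> n) r \<delta>"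
    using \<delta>(3) assms(14)
  proof eventually_elim
    case (elim n)
    \<comment> \<open>The bound on \<open>\<eta> n\<close> says that \<open>\<nu> n\<close> is a
      near minimizer; the case split deals with infinite values in the \<open>ereal\<close>
      subtraction.\<close>
    have "discrete_action L (h n) (\<tau> n) (\<nu> n) \<le> discrete_min L (h n) (\<tau> n) + ereal (\<epsilon> n)"
      using elim(2) assms(12)
      by (cases "discrete_action L (h n) (\<tau> n) (\<nu> n)"; cases "discrete_min L (h n) (\<tau> n)") auto
    then have "\<nu> n \<in> near_minimizers L (h n) (\<tau> n) (\<epsilon> n)"
      using hol by (simp add: near_minimizers_def)
    \<comment> \<open>One admissible measure suffices: \<open>max_mass\<close> is at least the
      smoothed mass of the reconstruction of \<open>\<nu> n\<close>, already at least
      \<open>\<delta>\<close> on the Mather set.\<close>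
    then show ?case
      using elim(1) max_mass_ge[OF assms(3) r]
      unfolding mass_threshold_set_def by (force intro: order_trans)
  qed
  then show "\<exists>\<delta>>0. \<delta> \<le> 1 \<and>
      (\<forall>\<^sub>F n in sequentially. mather_set L \<subseteq> mass_threshold_set \<kappa> L (h n) (\<tau> n) (\<epsilon> n) r \<delta>)"
    using \<delta>(1,2) by blast
qed

end
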